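(* Let $G$ be a connected $(v,k,\lambda,\mu)$-SRG that has at least one disconnecting set $S$ such that every component of $G\setminus S$ has at least two vertices. If $\lambda-\mu\in\{-1,0,1\}$ and $k\geq 2\lambda+1$, then $\kappa_2(G)=2k-\lambda-2$.
   Context: All graphs are finite and simple. A graph $G$ is a $(v,k,\lambda,\mu)$-SRG (strongly regular graph) if it has $v$ vertices, is $k$-regular, any two adjacent vertices have exactly $\lambda$ common neighbors, and any two distinct non-adjacent vertices have exactly $\mu$ common neighbors. A disconnecting set of a connected graph $G$ is a set $S$ of vertices such that $G\setminus S$ is disconnected. If $G$ has a disconnecting set $S$ such that every component of $G\setminus S$ has at least two vertices, then $\kappa_2(G)$ denotes the minimum size of such a set. *)

theory Defs
  imports "Graph_Theory.Graph_Theory"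
begin

text \<open>
  Finite simple graphs are the loopfree symmetric digraphs without parallel arcs of the locale
  \<^locale>\<open>graph\<close>: an edge is a pair of opposite arcs, so the degree of a vertex is its out-degree.
  The constant \<^const>\<open>Digraph_Component.connected\<close> is written qualified because
  \<^const>\<open>Topological_Spaces.connected\<close> has the same base name.
\<close>

definition common_neighbours :: "('a, 'b) pre_digraph \<Rightarrow> 'a \<Rightarrow> 'a \<Rightarrow> 'a set" where
  "common_neighbours G x y = {z \<in> verts G. x \<rightarrow>\<^bsub>G\<^esub> z \<and> y \<rightarrow>\<^bsub>G\<^esub> z}"

locale strongly_regular_graph = graph G
  for G :: "('a, 'b) pre_digraph" and v k l m :: nat +
  assumes card_verts: "card (verts G) = v"
    and regular: "x \<in> verts G \<Longrightarrow> out_degree G x = k"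
    and adjacent: "\<lbrakk>x \<in> verts G; y \<in> verts G; x \<rightarrow>\<^bsub>G\<^esub> y\<rbrakk> \<Longrightarrow> card (common_neighbours G x y) = l"
    and nonadjacent: "\<lbrakk>x \<in> verts G; y \<in> verts G; x \<noteq> y; \<not> x \<rightarrow>\<^bsub>G\<^esub> y\<rbrakk>
      \<Longrightarrow> card (common_neighbours G x y) = m"

definition components :: "('a, 'b) pre_digraph \<Rightarrow> ('a, 'b) pre_digraph set" where
  "components G = {C. pre_digraph.max_subgraph G Digraph_Component.connected C}"

definition remove_verts :: "('a, 'b) pre_digraph \<Rightarrow> 'a set \<Rightarrow> ('a, 'b) pre_digraph" where
  "remove_verts G S = G \<restriction> (verts G - S)"

text \<open>
  The null graph is not \<^const>\<open>Digraph_Component.connected\<close>, but it is not disconnected either: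
  without the condition \<^prop>\<open>S \<noteq> verts G\<close>, the whole vertex set would be a disconnecting set all of
  whose (zero) components are large.
\<close>

definition disconnecting_set :: "('a, 'b) pre_digraph \<Rightarrow> 'a set \<Rightarrow> bool" where
  "disconnecting_set G S \<longleftrightarrow>
     S \<subseteq> verts G \<and> S \<noteq> verts G \<and> \<not> Digraph_Component.connected (remove_verts G S)"

definition nonsingleton_disconnecting_set :: "('a, 'b) pre_digraph \<Rightarrow> 'a set \<Rightarrow> bool" where
  "nonsingleton_disconnecting_set G S \<longleftrightarrow>
     disconnecting_set G S \<and> (\<forall>C \<in> components (remove_verts G S). 2 \<le> card (verts C))"

text \<open>Only meaningful if \<^term>\<open>G\<close> has a nonsingleton disconnecting set.\<close>

definition kappa2 :: "('a, 'b) pre_digraph \<Rightarrow> nat" where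
  "kappa2 G = (LEAST n. \<exists>S. nonsingleton_disconnecting_set G S \<and> card S = n)"

end

theory Submission
  imports Defs "HOL-Analysis.Convex"
begin

text \<open>
  Lower bound. Write \<open>\<delta> = l - m\<close>, \<open>R = k - m + \<delta>\<^sup>2 / 4\<close>, and let \<open>A\<close>, \<open>B\<close> be separated by \<open>S\<close>. The matrix
  \<open>M = Adj - (\<delta> / 2) I\<close> satisfies \<open>M\<^sup>2 = R I + m J\<close>, and \<open>M 1\<^sub>B\<close> vanishes on \<open>A\<close>, so the Cauchy-Schwarz
  inequality on the complement of \<open>A\<close> gives \<open>m |A| |B| \<le> R |S|\<close>. If both sides contain an edge \<open>xy\<close>,
  whose \<open>2 k - l\<close> neighbours lie in that side or in \<open>S\<close>, then \<open>|S| < 2 k - l - 2\<close> forces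
  \<open>|A|, |B| \<ge> 3\<close>, hence \<open>|A| |B| \<ge> 3 (v - |S|) - 9\<close>, which contradicts the inequality when
  \<open>\<delta> \<in> {-1, 0, 1}\<close> and \<open>k \<ge> 2 l + 1\<close>.

  Upper bound. The neighbours of any edge \<open>xy\<close>, other than \<open>x\<close> and \<open>y\<close>, form a disconnecting set of size
  \<open>2 k - l - 2\<close>. A vertex \<open>z\<close> isolated by it has all its neighbours among those of \<open>x\<close> and \<open>y\<close>, so
  \<open>k \<le> 2 m\<close>, and this leaves only the conference graph parameters \<open>k = 2 m\<close>, \<open>l = m - 1\<close>. These are excluded
  by parity: counting the neighbours that a vertex shares with \<open>x\<close>, \<open>y\<close> and \<open>z\<close> shows that \<open>m\<close> is
  even when the vertex is adjacent to \<open>x\<close> and \<open>y\<close>, and odd when it is adjacent to \<open>x\<close> and \<open>z\<close>.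
\<close>

section \<open>Components and disconnecting sets of graphs\<close>

lemma (in wf_digraph) connected_if_reachable_from:
  assumes "symmetric G" "u \<in> verts G" "\<And>w. w \<in> verts G \<Longrightarrow> u \<rightarrow>\<^sup>*\<^bsub>G\<^esub> w"
  shows "Digraph_Component.connected G"
proof (rule connectedI)
  show "verts G \<noteq> {}" using assms(2) by auto
  show "a \<rightarrow>\<^sup>*\<^bsub>mk_symmetric G\<^esub> b" if "a \<in> verts G" "b \<in> verts G" for a b
    using assms that by (meson reachable_mk_symmetricI reachable_trans symmetric_reachable)
qed

text \<open>Maximality: a connected subgraph \<open>y\<close> of \<open>G\<close> that contains the
  graph induced on the reachable set has \<open>u\<close> as a vertex. By symmetry of
  \<open>G\<close> all its vertices are then reachable from \<open>u\<close>, so it has no further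
  vertices or arcs.\<close>

lemma (in sym_digraph) connected_component_of:
  assumes "u \<in> verts G"
  shows "G \<restriction> {w. u \<rightarrow>\<^sup>*\<^bsub>G\<^esub> w} \<in> components G"
proof -
  let ?R = "{w. u \<rightarrow>\<^sup>*\<^bsub>G\<^esub> w}"
  have sub: "?R \<subseteq> verts G" by (auto elim: reachable_in_vertsE)
  interpret R: sym_digraph "G \<restriction> ?R"
    using induced_graph_imp_graph induced_induce sub by blast
  have "Digraph_Component.connected (G \<restriction> ?R)"
    using assms by (intro R.connected_if_reachable_from[of u] R.sym_arcs)
      (auto intro: induce_reachable_preserves_paths)
  moreover have "y = G \<restriction> ?R"
    if y: "subgraph (G \<restriction> ?R) y" "subgraph y G" "Digraph_Component.connected y" for y
  proof -
    have u: "u \<in> verts y" using subgraph_imp_subverts[OF y(1)] assms by auto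
    have "w \<in> ?R" if "w \<in> verts y" for w
    proof -
      have "u \<rightarrow>\<^sup>*\<^bsub>mk_symmetric y\<^esub> w"
        using y(3) u that by (auto simp: Digraph_Component.connected_def)
      then have "u \<rightarrow>\<^sup>*\<^bsub>mk_symmetric G\<^esub> w"
        using subgraph_mk_symmetric[OF y(2)] pre_digraph.reachable_mono by metis
      then show ?thesis using reachable_mk_symmetric_eq sym_arcs by auto
    qed
    then have V: "verts y = ?R" using subgraph_imp_subverts[OF y(1)] by auto
    moreover have "arcs y = arcs (G \<restriction> ?R)"
    proof
      show "arcs (G \<restriction> ?R) \<subseteq> arcs y" using y(1) by blast
      interpret y: wf_digraph y using y(2) by blast
      show "arcs y \<subseteq> arcs (G \<restriction> ?R)"
        using y(2) y.wellformed V by (fastforce simp: subgraph_def compatible_def)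
    qed
    ultimately show ?thesis using y(2) by (auto simp: subgraph_def compatible_def)
  qed
  ultimately show ?thesis
    unfolding components_def using subgraph_induce_subgraphI[OF sub]
    by (auto intro!: max_subgraphI)
qed

text \<open>Trades component sizes for the absence of isolated vertices. A path from
  \<open>u\<close> to a second vertex starts with an arc at \<open>u\<close>; conversely, a
  component with sole vertex \<open>u\<close> is not maximal if \<open>u\<close> has a neighbour
  \<open>w\<close>, since \<open>{u, w}\<close> induces a connected graph.\<close>

lemma (in graph) components_card_ge_2_iff:
  "(\<forall>C \<in> components G. 2 \<le> card (verts C)) \<longleftrightarrow> (\<forall>u \<in> verts G. \<exists>w. u \<rightarrow>\<^bsub>G\<^esub> w)"
proof (intro iffI ballI)
  fix u assume C: "\<forall>C \<in> components G. 2 \<le> card (verts C)" and u: "u \<in> verts G"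
  have "\<not> {w. u \<rightarrow>\<^sup>*\<^bsub>G\<^esub> w} \<subseteq> {u}"
    using bspec[OF C connected_component_of[OF u]] card_mono[of "{u}" "{w. u \<rightarrow>\<^sup>*\<^bsub>G\<^esub> w}"]
    by auto
  then obtain w where "u \<rightarrow>\<^sup>*\<^bsub>G\<^esub> w" "w \<noteq> u" by auto
  then show "\<exists>w. u \<rightarrow>\<^bsub>G\<^esub> w"
    by (metis converse_reachable_cases)
next
  fix C assume nb: "\<forall>u \<in> verts G. \<exists>w. u \<rightarrow>\<^bsub>G\<^esub> w" and "C \<in> components G"
  then have C: "max_subgraph Digraph_Component.connected C" by (simp add: components_def)
  then have sub: "subgraph C G" and con: "Digraph_Component.connected C"
    by (auto simp: max_subgraph_def)
  have fin: "finite (verts C)" using subgraph_imp_subverts[OF sub] finite_verts by (rule finite_subset)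
  obtain u where u: "u \<in> verts C"
    using con by (auto simp: Digraph_Component.connected_def strongly_connected_def)
  show "2 \<le> card (verts C)"
  proof (rule ccontr)
    assume "\<not> 2 \<le> card (verts C)"
    moreover have "card (verts C) \<noteq> 0" using u fin by auto
    ultimately have "card (verts C) = 1" by linarith
    then have V: "verts C = {u}" using u by (auto simp: card_1_singleton_iff)
    obtain w where w: "u \<rightarrow>\<^bsub>G\<^esub> w" using nb u subgraph_imp_subverts[OF sub] by blast
    let ?H = "G \<restriction> {u, w}"
    have uw: "{u, w} \<subseteq> verts G" using w adj_in_verts by auto
    interpret H: sym_digraph ?H
      using induced_graph_imp_graph induced_induce uw by blast
    have "u \<rightarrow>\<^bsub>?H\<^esub> w" using w by (auto simp: arcs_ends_conv)
    then have "Digraph_Component.connected ?H"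
      by (intro H.connected_if_reachable_from[of u] H.sym_arcs) auto
    moreover have "subgraph C ?H"
    proof -
      have "subgraph C (G \<restriction> {u})" using subgraph_induce_subgraphI2[OF sub] V by simp
      moreover have "subgraph (G \<restriction> {u}) ?H"
        by (intro subgraphI) (auto simp: compatible_def)
      ultimately show ?thesis by (rule subgraph_trans)
    qed
    moreover have "?H \<noteq> C" using V w adj_not_same by (metis induce_subgraph_verts insertI1 insertI2 singletonD)
    ultimately show False
      using C subgraph_induce_subgraphI[OF uw] by (auto simp: max_subgraph_def)
  qed
qed

section \<open>Deletion of a set of vertices\<close>

lemma (in wf_digraph) dominates_remove_verts_iff:
  "x \<rightarrow>\<^bsub>remove_verts G S\<^esub> y \<longleftrightarrow> x \<rightarrow>\<^bsub>G\<^esub> y \<and> x \<notin> S \<and> y \<notin> S"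
  by (auto simp: remove_verts_def arcs_ends_conv)

lemma verts_remove_verts [simp]: "verts (remove_verts G S) = verts G - S"
  by (simp add: remove_verts_def)

lemma (in graph) graph_remove_verts: "graph (remove_verts G S)"
proof -
  have ind: "induced_subgraph (remove_verts G S) G"
    unfolding remove_verts_def by (rule induced_induce) auto
  interpret H: digraph "remove_verts G S"
    using ind by (rule digraphI_induced)
  show ?thesis
    by (rule H.graphI[OF induced_graph_imp_symmetric[OF sym_arcs ind]])
qed

lemma (in graph) nonsingleton_disconnecting_set_iff:
  "nonsingleton_disconnecting_set G S \<longleftrightarrow> disconnecting_set G S \<and>
    (\<forall>x \<in> verts G - S. \<exists>y. x \<rightarrow>\<^bsub>G\<^esub> y \<and> y \<notin> S)"
  unfolding nonsingleton_disconnecting_set_def dominates_remove_verts_iff verts_remove_verts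
    graph.components_card_ge_2_iff[OF graph_remove_verts]
  by auto

text \<open>\<open>A\<close> collects what is reachable from some remaining vertex, and
  \<open>B\<close> is the rest, nonempty because the remaining graph is not connected. No remaining
  vertex is isolated and \<open>A\<close> is closed under adjacency, so each side contains an
  edge.\<close>

lemma (in graph) nonsingleton_disconnecting_set_sides:
  assumes "nonsingleton_disconnecting_set G S"
  obtains A B x y x' y' where "verts G = A \<union> B \<union> S" "A \<inter> B = {}" "(A \<union> B) \<inter> S = {}"
    "\<forall>a\<in>A. \<forall>b\<in>B. \<not> a \<rightarrow>\<^bsub>G\<^esub> b"
    "x \<in> A" "y \<in> A" "x \<rightarrow>\<^bsub>G\<^esub> y" "x' \<in> B" "y' \<in> B" "x' \<rightarrow>\<^bsub>G\<^esub> y'"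
proof -
  interpret H: graph "remove_verts G S" by (rule graph_remove_verts)
  have S: "S \<subseteq> verts G" "S \<noteq> verts G" "\<not> Digraph_Component.connected (remove_verts G S)"
    and nb: "\<And>x. x \<in> verts G - S \<Longrightarrow> \<exists>y. x \<rightarrow>\<^bsub>remove_verts G S\<^esub> y"
    using assms by (auto simp: nonsingleton_disconnecting_set_iff disconnecting_set_def
        dominates_remove_verts_iff)
  obtain x where x: "x \<in> verts G - S" using S by blast
  define A where "A = {w. x \<rightarrow>\<^sup>*\<^bsub>remove_verts G S\<^esub> w}"
  define B where "B = verts G - S - A"
  have A: "A \<subseteq> verts G - S"
    using H.reachable_in_verts by (auto simp: A_def)
  have xA: "x \<in> A" using x by (simp add: A_def)
  have step: "w \<in> A" if "a \<in> A" "a \<rightarrow>\<^bsub>remove_verts G S\<^esub> w" for a w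
    using that H.reachable_adj_trans by (auto simp: A_def)
  obtain y where y: "x \<rightarrow>\<^bsub>remove_verts G S\<^esub> y" using nb x by blast
  have "B \<noteq> {}"
  proof
    assume "B = {}"
    then have "Digraph_Component.connected (remove_verts G S)"
      using x by (intro H.connected_if_reachable_from[of x] H.sym_arcs) (auto simp: A_def B_def)
    then show False using S by blast
  qed
  then obtain x' where x': "x' \<in> B" by blast
  then obtain y' where y': "x' \<rightarrow>\<^bsub>remove_verts G S\<^esub> y'" using nb by (auto simp: B_def)
  \<comment> \<open>If \<open>y'\<close> were in \<open>A\<close>, the reversed arc would put
    \<open>x'\<close> into \<open>A\<close> as well.\<close>
  have "y' \<in> B"
    using y' x' step H.graph_symmetric[OF y'] H.adj_in_verts[OF y'] by (auto simp: B_def)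
  show thesis
  proof (rule that[of A B x y x' y'])
    show "\<forall>a\<in>A. \<forall>b\<in>B. \<not> a \<rightarrow>\<^bsub>G\<^esub> b"
      using step A by (auto simp: B_def dominates_remove_verts_iff)
  qed (use A S xA step y x' y' \<open>y' \<in> B\<close> in \<open>auto simp: B_def dominates_remove_verts_iff\<close>)
qed

section \<open>Strongly regular graphs\<close>

definition neighbours :: "('a, 'b) pre_digraph \<Rightarrow> 'a \<Rightarrow> 'a set" where
  "neighbours G x = {y. x \<rightarrow>\<^bsub>G\<^esub> y}"

lemma in_neighbours_iff [simp]: "y \<in> neighbours G x \<longleftrightarrow> x \<rightarrow>\<^bsub>G\<^esub> y"
  by (simp add: neighbours_def)

lemma (in wf_digraph) neighbours_subset: "neighbours G x \<subseteq> verts G"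
  using adj_in_verts by auto

lemma (in wf_digraph) common_neighbours_eq:
  "common_neighbours G x y = neighbours G x \<inter> neighbours G y"
  using adj_in_verts by (auto simp: common_neighbours_def)

lemma (in fin_digraph) finite_neighbours [simp]: "finite (neighbours G x)"
  using neighbours_subset finite_verts by (rule finite_subset)

lemma (in nomulti_digraph) card_neighbours: "card (neighbours G x) = out_degree G x"
proof -
  have "inj_on (head G) (out_arcs G x)"
    using no_multi_arcs by (auto simp: inj_on_def arc_to_ends_def)
  moreover have "head G ` out_arcs G x = neighbours G x"
    by (auto simp: arcs_ends_conv)
  ultimately show ?thesis
    by (metis card_image out_degree_def)
qed

section \<open>Double counting of neighbours in a set of vertices\<close>

lemma real_card_neighbours_Int:
  assumes "finite B"
  shows "real (card (neighbours G x \<inter> B)) = (\<Sum>y\<in>B. of_bool (x \<rightarrow>\<^bsub>G\<^esub> y))"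
  using assms by (simp add: neighbours_def Int_commute)

context strongly_regular_graph
begin

lemma card_neighbours_eq: "x \<in> verts G \<Longrightarrow> card (neighbours G x) = k"
  using card_neighbours regular by simp

lemma card_neighbours_Int_neighbours:
  assumes "x \<in> verts G" "y \<in> verts G"
  shows "card (neighbours G x \<inter> neighbours G y) = (if x = y then k else if x \<rightarrow>\<^bsub>G\<^esub> y then l else m)"
  using assms adjacent nonadjacent card_neighbours_eq common_neighbours_eq by auto

lemma sum_card_neighbours_Int:
  assumes "B \<subseteq> verts G"
  shows "(\<Sum>x\<in>verts G. real (card (neighbours G x \<inter> B))) = real k * real (card B)"
proof -
  have fin: "finite B" using assms finite_verts by (rule finite_subset)
  have "(\<Sum>x\<in>verts G. real (card (neighbours G x \<inter> B)))
      = (\<Sum>y\<in>B. \<Sum>x\<in>verts G. of_bool (x \<rightarrow>\<^bsub>G\<^esub> y))"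
    by (simp only: real_card_neighbours_Int[OF fin]) (rule sum.swap)
  also have "\<dots> = (\<Sum>y\<in>B. real k)"
  proof (rule sum.cong)
    fix y assume "y \<in> B"
    then have y: "y \<in> verts G" using assms by blast
    have "(\<Sum>x\<in>verts G. of_bool (x \<rightarrow>\<^bsub>G\<^esub> y)) = (\<Sum>x\<in>verts G. of_bool (y \<rightarrow>\<^bsub>G\<^esub> x) :: real)"
      using graph_symmetric by (intro sum.cong) auto
    also have "\<dots> = real (card (neighbours G y))"
      using real_card_neighbours_Int[OF finite_verts, of G y] neighbours_subset by (simp add: Int_absorb2)
    finally show "(\<Sum>x\<in>verts G. of_bool (x \<rightarrow>\<^bsub>G\<^esub> y)) = real k"
      using card_neighbours_eq y by simp
  qed simp
  finally show ?thesis by simp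
qed

text \<open>The squared norm of \<open>Adj 1\<^sub>B\<close>, computed from
  \<open>Adj\<^sup>2 = m J + (k - m) I + (l - m) Adj\<close>: expand the square into pairs
  \<open>y\<close>, \<open>z\<close> in \<open>B\<close> and count their common neighbours.\<close>

lemma sum_card_neighbours_Int_squared:
  assumes "B \<subseteq> verts G"
  shows "(\<Sum>x\<in>verts G. (real (card (neighbours G x \<inter> B)))\<^sup>2)
    = real m * (real (card B))\<^sup>2 + (real k - real m) * real (card B)
      + (real l - real m) * (\<Sum>y\<in>B. real (card (neighbours G y \<inter> B)))"
proof -
  have fin: "finite B" using assms finite_verts by (rule finite_subset)
  have "(\<Sum>x\<in>verts G. (real (card (neighbours G x \<inter> B)))\<^sup>2)
      = (\<Sum>x\<in>verts G. \<Sum>y\<in>B. \<Sum>z\<in>B. of_bool (x \<rightarrow>\<^bsub>G\<^esub> y) * of_bool (x \<rightarrow>\<^bsub>G\<^esub> z))"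
    by (simp only: real_card_neighbours_Int[OF fin] power2_eq_square sum_product)
  also have "\<dots> = (\<Sum>y\<in>B. \<Sum>z\<in>B. \<Sum>x\<in>verts G. of_bool (x \<rightarrow>\<^bsub>G\<^esub> y) * of_bool (x \<rightarrow>\<^bsub>G\<^esub> z))"
    by (subst sum.swap) (simp only: sum.swap[of _ B "verts G"])
  also have "\<dots> = (\<Sum>y\<in>B. \<Sum>z\<in>B. real m + (if y = z then real k - real m else 0)
      + (real l - real m) * of_bool (y \<rightarrow>\<^bsub>G\<^esub> z))"
  proof (intro sum.cong refl)
    fix y z assume "y \<in> B" "z \<in> B"
    then have yz: "y \<in> verts G" "z \<in> verts G" using assms by auto
    have "(\<Sum>x\<in>verts G. of_bool (x \<rightarrow>\<^bsub>G\<^esub> y) * of_bool (x \<rightarrow>\<^bsub>G\<^esub> z))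
        = (\<Sum>x\<in>verts G. of_bool (x \<in> neighbours G y \<inter> neighbours G z) :: real)"
      using graph_symmetric by (intro sum.cong) auto
    also have "\<dots> = real (card (neighbours G y \<inter> neighbours G z))"
    proof -
      have "verts G \<inter> {x. x \<in> neighbours G y \<inter> neighbours G z} = neighbours G y \<inter> neighbours G z"
        using neighbours_subset by blast
      then show ?thesis by (simp only: sum_of_bool_eq[OF finite_verts finite_verts])
    qed
    finally show "(\<Sum>x\<in>verts G. of_bool (x \<rightarrow>\<^bsub>G\<^esub> y) * of_bool (x \<rightarrow>\<^bsub>G\<^esub> z))
        = real m + (if y = z then real k - real m else 0) + (real l - real m) * of_bool (y \<rightarrow>\<^bsub>G\<^esub> z)"
      using card_neighbours_Int_neighbours[OF yz] adj_not_same by auto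
  qed
  also have "\<dots> = real m * (real (card B))\<^sup>2 + (real k - real m) * real (card B)
      + (real l - real m) * (\<Sum>y\<in>B. real (card (neighbours G y \<inter> B)))"
    by (simp only: real_card_neighbours_Int[OF fin] sum.distrib sum_distrib_left sum.delta'[OF fin]
        sum_constant if_True cong: sum.cong) (simp add: power2_eq_square algebra_simps)
  finally show ?thesis .
qed

text \<open>The case \<open>B = verts G\<close> of the previous identity, divided by
  \<open>v\<close>. It is the familiar \<open>k (k - l - 1) = (v - k - 1) m\<close> in another
  arrangement.\<close>

lemma parameter_identity:
  assumes "verts G \<noteq> {}"
  shows "(real k)\<^sup>2 = real m * real v + (real k - real m) + (real l - real m) * real k"
proof -
  have "real v > 0" using assms card_verts by (metis card_gt_0_iff finite_verts of_nat_0_less_iff)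
  have d: "card (neighbours G x \<inter> verts G) = k" if "x \<in> verts G" for x
    using card_neighbours_eq[OF that] neighbours_subset by (simp add: Int_absorb2)
  have "real v * (real k)\<^sup>2 = real v * (real m * real v + (real k - real m) + (real l - real m) * real k)"
    using sum_card_neighbours_Int_squared[OF order_refl] d card_verts
    by (simp add: power2_eq_square algebra_simps)
  then show ?thesis using \<open>real v > 0\<close> by simp
qed

lemma separation_bound:
  assumes A: "A \<subseteq> verts G" and B: "B \<subseteq> verts G" "B \<noteq> {}" and disj: "A \<inter> B = {}"
    and sep: "\<And>x y. \<lbrakk>x \<in> A; y \<in> B\<rbrakk> \<Longrightarrow> \<not> x \<rightarrow>\<^bsub>G\<^esub> y"
  shows "real m * real (card A) * real (card B)
    \<le> (real k - real m + (real l - real m)\<^sup>2 / 4) * (real v - real (card A) - real (card B))"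
proof -
  define \<delta> where "\<delta> = real l - real m"
  define R where "R = real k - real m + \<delta>\<^sup>2 / 4"
  define b where "b = real (card B)"
  define d where "d x = real (card (neighbours G x \<inter> B))" for x
  \<comment> \<open>\<open>g\<close> is the vector \<open>M 1\<^sub>B\<close>. The shift by
    \<open>\<delta> / 2\<close> cancels the term of \<open>Adj\<^sup>2\<close> that is linear in
    \<open>Adj\<close>, so the unknown \<open>sum d B\<close> drops out of the norm of
    \<open>g\<close>.\<close>
  define g where "g x = d x - \<delta> / 2 * of_bool (x \<in> B)" for x
  have finB: "finite B" using B(1) finite_verts by (rule finite_subset)
  have b: "b > 0" using B finB by (simp add: b_def card_gt_0_iff)
  have inB: "(\<Sum>x\<in>verts G. f x * of_bool (x \<in> B)) = sum f B" for f :: "'a \<Rightarrow> real"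
    using B(1) by (simp add: Int_absorb1)
  have gA: "g x = 0" if "x \<in> A" for x
  proof -
    have "neighbours G x \<inter> B = {}" using sep that by auto
    then show ?thesis using that disj by (auto simp: g_def d_def)
  qed
  have W: "sum f (verts G - A) = sum f (verts G)" if "\<And>x. x \<in> A \<Longrightarrow> f x = 0" for f :: "'a \<Rightarrow> real"
    using that A by (intro sum.mono_neutral_left) auto
  have g1: "sum g (verts G) = (real k - \<delta> / 2) * b"
  proof -
    have "sum g (verts G) = sum d (verts G) - (\<Sum>x\<in>verts G. \<delta> / 2 * of_bool (x \<in> B))"
      by (simp add: g_def sum_subtractf)
    also have "\<dots> = (real k - \<delta> / 2) * b"
      unfolding inB using sum_card_neighbours_Int[OF B(1)] by (simp add: d_def b_def algebra_simps)
    finally show ?thesis .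
  qed
  have g2: "(\<Sum>x\<in>verts G. (g x)\<^sup>2) = R * b + real m * b\<^sup>2"
  proof -
    have "(\<Sum>x\<in>verts G. (g x)\<^sup>2)
        = (\<Sum>x\<in>verts G. (d x)\<^sup>2 + (\<delta>\<^sup>2 / 4 - \<delta> * d x) * of_bool (x \<in> B))"
      by (intro sum.cong) (auto simp: g_def power2_eq_square field_simps)
    also have "\<dots> = (\<Sum>x\<in>verts G. (d x)\<^sup>2) + (\<Sum>x\<in>B. \<delta>\<^sup>2 / 4 - \<delta> * d x)"
      by (simp only: sum.distrib inB)
    also have "(\<Sum>x\<in>B. \<delta>\<^sup>2 / 4 - \<delta> * d x) = b * (\<delta>\<^sup>2 / 4) - \<delta> * sum d B"
      by (simp add: sum_subtractf sum_distrib_left b_def)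
    also have "(\<Sum>x\<in>verts G. (d x)\<^sup>2) = real m * b\<^sup>2 + (real k - real m) * b + \<delta> * sum d B"
      using sum_card_neighbours_Int_squared[OF B(1)] by (simp add: d_def b_def \<delta>_def)
    also have "real m * b\<^sup>2 + (real k - real m) * b + \<delta> * sum d B + (b * (\<delta>\<^sup>2 / 4) - \<delta> * sum d B)
        = R * b + real m * b\<^sup>2"
      by (simp add: R_def algebra_simps)
    finally show ?thesis .
  qed
  have cardW: "real (card (verts G - A)) = real v - real (card A)"
    using A card_verts card_mono[OF finite_verts A]
    by (simp add: card_Diff_subset finite_subset of_nat_diff)
  \<comment> \<open>Cauchy-Schwarz is applied only where \<open>g\<close> can be nonzero; this is
    how \<open>card A\<close> enters.\<close>
  have "(sum g (verts G - A))\<^sup>2 \<le> (\<Sum>x\<in>verts G - A. (g x)\<^sup>2) * card (verts G - A)"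
    by (rule sum_squared_le_sum_of_squares)
  then have "((real k - \<delta> / 2) * b)\<^sup>2 \<le> (R * b + real m * b\<^sup>2) * (real v - real (card A))"
    using gA by (simp add: W g1 g2 cardW)
  moreover have "verts G \<noteq> {}" using B by blast
  \<comment> \<open>The all-ones vector is an eigenvector of \<open>M\<close> with eigenvalue
    \<open>k - \<delta> / 2\<close>, hence of \<open>M\<^sup>2\<close> with eigenvalue
    \<open>R + m v\<close>.\<close>
  then have "(real k - \<delta> / 2)\<^sup>2 = R + real m * real v"
    using parameter_identity by (simp add: R_def \<delta>_def power2_eq_square field_simps)
  ultimately have "(R + real m * real v) * b\<^sup>2 \<le> (R * b + real m * b\<^sup>2) * (real v - real (card A))"
    by (simp only: power_mult_distrib)
  then have "b * ((R + real m * real v) * b) \<le> b * ((R + real m * b) * (real v - real (card A)))"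
    by (simp add: power2_eq_square algebra_simps)
  then have "(R + real m * real v) * b \<le> (R + real m * b) * (real v - real (card A))"
    using b by simp
  then have "real m * real (card A) * b \<le> R * (real v - real (card A) - b)"
    by (simp add: algebra_simps)
  then show ?thesis
    by (simp only: R_def \<delta>_def b_def)
qed

end

section \<open>The lower bound\<close>

text \<open>Here \<open>a\<close>, \<open>b\<close>, \<open>t\<close> are the sizes of the two sides
  and of the separator. Bounding \<open>a * b\<close> from below and \<open>t\<close> from above,
  then eliminating \<open>v\<close> by \<open>eq\<close>, leaves an inequality in \<open>k\<close>,
  \<open>l\<close>, \<open>m\<close> alone.\<close>

lemma separator_parameters_contradiction:
  fixes a b t v k l m :: real
  assumes ge: "2 * k - l \<le> a + t" "2 * k - l \<le> b + t" and v: "v = a + b + t"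
    and t: "t \<le> 2 * k - l - 3"
    and k: "k \<ge> 2 * l + 1" and l: "l \<ge> 0" and m: "m \<ge> 0" and lm: "l - m \<in> {-1, 0, 1}"
    and eq: "k\<^sup>2 = m * v + (k - m) + (l - m) * k"
    and sep: "m * a * b \<le> (k - m + (l - m)\<^sup>2 / 4) * t"
  shows False
proof -
  \<comment> \<open>\<open>ge\<close> and \<open>t\<close> give \<open>a \<ge> 3\<close> and
    \<open>b \<ge> 3\<close>. The expanded product bounds \<open>a * b\<close> by a linear function
    of \<open>a + b = v - t\<close>.\<close>
  have "0 \<le> (a - 3) * (b - 3)"
    using ge t by (intro mult_nonneg_nonneg) linarith+
  then have "m * (3 * (v - t) - 9) \<le> m * (a * b)"
    using m v by (intro mult_left_mono) (simp_all add: algebra_simps)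
  with sep have "3 * m * v - 9 * m \<le> (k + 2 * m + (l - m)\<^sup>2 / 4) * t"
    by (simp add: algebra_simps)
  also have "\<dots> \<le> (k + 2 * m + (l - m)\<^sup>2 / 4) * (2 * k - l - 3)"
    using t k l m by (intro mult_left_mono) auto
  finally have *: "3 * (k\<^sup>2 - (k - m) - (l - m) * k) - 9 * m
      \<le> (k + 2 * m + (l - m)\<^sup>2 / 4) * (2 * k - l - 3)"
    using eq by simp
  \<comment> \<open>In terms of \<open>j\<close> and \<open>l\<close>, both nonnegative, the left
    side of \<open>*\<close> minus the right side is in each case a polynomial with nonnegative
    coefficients and a positive constant term.\<close>
  define j where "j = k - 2 * l - 1"
  have j: "j \<ge> 0" "k = 2 * l + 1 + j" using k by (simp_all add: j_def)
  have jl: "0 \<le> j * l" "0 \<le> j * j" using j l by simp_all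
  consider "m = l + 1" | "m = l" | "m = l - 1" using lm by force
  then show False
  proof cases
    case 1
    show ?thesis
      using * jl j(1) l unfolding 1 j(2) by (simp add: algebra_simps power2_eq_square)
  next
    case 2
    show ?thesis
      using * jl j(1) l unfolding 2 j(2) by (simp add: algebra_simps power2_eq_square)
  next
    case 3
    show ?thesis
      using * jl j(1) l unfolding 3 j(2) by (simp add: algebra_simps power2_eq_square)
  qed
qed

section \<open>Sizes of separators and of their sides\<close>

context strongly_regular_graph
begin

text \<open>Inclusion-exclusion. The union includes \<open>x\<close> and \<open>y\<close>
  themselves, each being a neighbour of the other.\<close>

lemma card_neighbours_Un_edge:
  assumes "x \<rightarrow>\<^bsub>G\<^esub> y"
  shows "card (neighbours G x \<union> neighbours G y) + l = 2 * k"
proof -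
  have xy: "x \<in> verts G" "y \<in> verts G" "x \<noteq> y" using assms adj_in_verts adj_not_same by auto
  then have "card (neighbours G x \<inter> neighbours G y) = l"
    using card_neighbours_Int_neighbours[OF xy(1,2)] assms by simp
  then show ?thesis
    using card_Un_Int[of "neighbours G x" "neighbours G y"] card_neighbours_eq xy by simp
qed

lemma card_side_ge:
  assumes "verts G = A \<union> B \<union> S" and "\<forall>a\<in>A. \<forall>b\<in>B. \<not> a \<rightarrow>\<^bsub>G\<^esub> b"
    and xy: "x \<in> A" "y \<in> A" "x \<rightarrow>\<^bsub>G\<^esub> y"
  shows "2 * k \<le> card A + card S + l"
proof -
  have fin: "finite (A \<union> S)" using assms(1) finite_verts by (metis finite_Un)
  have "neighbours G x \<union> neighbours G y \<subseteq> A \<union> S"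
  proof
    fix u assume u: "u \<in> neighbours G x \<union> neighbours G y"
    then have "u \<in> verts G" using neighbours_subset by blast
    moreover have "u \<notin> B" using u assms(2) xy by auto
    ultimately show "u \<in> A \<union> S" using assms(1) by blast
  qed
  then have "card (neighbours G x \<union> neighbours G y) \<le> card A + card S"
    using card_mono[OF fin] card_Un_le[of A S] by (meson le_trans)
  then show ?thesis using card_neighbours_Un_edge[OF xy(3)] by linarith
qed

lemma card_nonsingleton_disconnecting_set_ge:
  assumes lm: "int l - int m \<in> {-1, 0, 1}" and k: "k \<ge> 2 * l + 1"
    and S: "nonsingleton_disconnecting_set G S"
  shows "2 * k \<le> card S + l + 2"
proof (rule ccontr)
  assume less: "\<not> 2 * k \<le> card S + l + 2"
  obtain A B x y x' y' where V: "verts G = A \<union> B \<union> S" "A \<inter> B = {}" "(A \<union> B) \<inter> S = {}"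
    and sep: "\<forall>a\<in>A. \<forall>b\<in>B. \<not> a \<rightarrow>\<^bsub>G\<^esub> b"
    and xy: "x \<in> A" "y \<in> A" "x \<rightarrow>\<^bsub>G\<^esub> y" "x' \<in> B" "y' \<in> B" "x' \<rightarrow>\<^bsub>G\<^esub> y'"
    by (rule nonsingleton_disconnecting_set_sides[OF S]) (rule that)
  have fin: "finite A" "finite B" "finite S" using V(1) finite_verts by (metis finite_Un)+
  have v: "v = card A + card B + card S"
    using V fin card_verts by (metis card_Un_disjoint finite_UnI)
  have "2 * k \<le> card A + card S + l"
    by (rule card_side_ge[OF V(1) sep xy(1,2,3)])
  moreover have "2 * k \<le> card B + card S + l"
  proof (rule card_side_ge[where x = x' and y = y'])
    show "verts G = B \<union> A \<union> S" using V(1) by blast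
    show "\<forall>b\<in>B. \<forall>a\<in>A. \<not> b \<rightarrow>\<^bsub>G\<^esub> a"
      using sep graph_symmetric by blast
  qed (use xy in auto)
  moreover have "real m * real (card A) * real (card B)
      \<le> (real k - real m + (real l - real m)\<^sup>2 / 4) * (real v - real (card A) - real (card B))"
  proof (rule separation_bound)
    show "A \<inter> B = {}" by (rule V(2))
    show "\<not> a \<rightarrow>\<^bsub>G\<^esub> b" if "a \<in> A" "b \<in> B" for a b
      using sep that by blast
  qed (use V(1) xy in auto)
  moreover have "real l - real m \<in> {-1, 0, 1}" using lm by auto
  moreover have "(real k)\<^sup>2 = real m * real v + (real k - real m) + (real l - real m) * real k"
    using V(1) xy by (intro parameter_identity) auto
  \<comment> \<open>By integrality \<open>less\<close> means
    \<open>card S \<le> 2 k - l - 3\<close>, the form that forces at least three vertices on each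
    side.\<close>
  ultimately show False
    using less k v
    by (intro separator_parameters_contradiction[of "real k" "real l" "real (card A)" "real (card S)"
          "real (card B)" "real v" "real m"]) simp_all
qed

text \<open>Each side contributes at least the two ends of an edge, on top of the bound for
  \<open>card S\<close>. This later leaves a vertex outside the neighbourhood of an edge and rules
  out the smallest parameters.\<close>

lemma card_verts_ge:
  assumes "int l - int m \<in> {-1, 0, 1}" "k \<ge> 2 * l + 1" "nonsingleton_disconnecting_set G S"
  shows "2 * k + 2 \<le> v + l"
proof -
  obtain A B x y x' y' where V: "verts G = A \<union> B \<union> S" "A \<inter> B = {}" "(A \<union> B) \<inter> S = {}"
    and xy: "x \<in> A" "y \<in> A" "x \<rightarrow>\<^bsub>G\<^esub> y" "x' \<in> B" "y' \<in> B" "x' \<rightarrow>\<^bsub>G\<^esub> y'"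
    by (rule nonsingleton_disconnecting_set_sides[OF assms(3)]) (rule that)
  have fin: "finite A" "finite B" "finite S" using V(1) finite_verts by (metis finite_Un)+
  have "v = card A + card B + card S"
    using V fin card_verts by (metis card_Un_disjoint finite_UnI)
  moreover have "card {x, y} \<le> card A" "card {x', y'} \<le> card B"
    using xy fin by (auto intro!: card_mono)
  moreover have "x \<noteq> y" "x' \<noteq> y'" using xy adj_not_same by auto
  ultimately show ?thesis
    using card_nonsingleton_disconnecting_set_ge[OF assms] by simp
qed

end

section \<open>The neighbours of an edge\<close>

context strongly_regular_graph
begin

text \<open>From \<open>2 l + 1 \<le> k \<le> 2 m\<close> and \<open>m \<le> l + 1\<close> it
  follows that \<open>m = l + 1\<close> and that \<open>k\<close> is \<open>2 m - 1\<close> or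
  \<open>2 m\<close>. The parameter identity then leaves the single edge in the first case and
  \<open>v = 4 m + 1\<close> in the second; the bound on \<open>v\<close> excludes the single edge
  and the pentagon.\<close>

lemma isolated_vertex_parameters:
  assumes lm: "int l - int m \<in> {-1, 0, 1}" and k: "k \<ge> 2 * l + 1" and v: "2 * k + 2 \<le> v + l"
    and k_le: "k \<le> 2 * m"
  shows "m = l + 1" "k = 2 * m" "m \<ge> 2"
proof -
  show m: "m = l + 1" using lm k k_le by auto
  have "verts G \<noteq> {}" using v k card_verts by auto
  then have eq: "(int k)\<^sup>2 = int m * int v + (int k - int m) + (int l - int m) * int k"
    using parameter_identity by (smt (verit, best) of_int_add of_int_diff of_int_eq_iff of_int_mult
        of_int_of_nat_eq of_int_power)
  show km: "k = 2 * m"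
  \<comment> \<open>Otherwise \<open>k = 2 l + 1\<close>, and the parameter identity shows that \<open>l + 1\<close> divides 1.\<close>
  proof (rule ccontr)
    assume "k \<noteq> 2 * m"
    then have k': "int k = 2 * int l + 1" using m k k_le by auto
    have "(int l + 1) * (int v - 1 - 4 * int l) = 1"
      using eq m unfolding k' by (simp add: power2_eq_square algebra_simps)
    then have "int l + 1 = 1" by (simp add: zmult_eq_1_iff)
    moreover from this have "int v = 2"
      using \<open>(int l + 1) * (int v - 1 - 4 * int l) = 1\<close> by simp
    ultimately show False using v k' by simp
  qed
  have "int m * (int v - 4 * int m - 1) = 0"
    using eq m unfolding km by (simp add: power2_eq_square algebra_simps)
  then have "int v = 4 * int m + 1" using m by simp
  \<comment> \<open>The bound on \<open>v\<close> now reads \<open>4 m + 2 \<le> 5 m\<close>, which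
    fails for the pentagon, \<open>m = 1\<close>.\<close>
  then show "m \<ge> 2" using v m km by simp
qed

text \<open>Otherwise the neighbours of \<open>z\<close> are covered by two sets of size
  \<open>m\<close>, and the forced equality \<open>k = 2 m\<close> makes these disjoint. The three
  neighbourhoods are then built from disjoint blocks \<open>A\<close>, \<open>B\<close>,
  \<open>C\<close> of sizes \<open>m - 1\<close>, \<open>m\<close>, \<open>m\<close>, and counting
  from a vertex of \<open>A\<close> and from one of \<open>B\<close> gives \<open>m\<close> opposite
  parities.\<close>

lemma neighbours_not_subset_edge_neighbours:
  assumes lm: "int l - int m \<in> {-1, 0, 1}" and k: "k \<ge> 2 * l + 1" and v: "2 * k + 2 \<le> v + l"
    and xy: "x \<rightarrow>\<^bsub>G\<^esub> y"
    and z: "z \<in> verts G" "\<not> x \<rightarrow>\<^bsub>G\<^esub> z" "\<not> y \<rightarrow>\<^bsub>G\<^esub> z"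
  shows "\<not> neighbours G z \<subseteq> neighbours G x \<union> neighbours G y"
proof
  let ?N = "neighbours G"
  assume sub: "?N z \<subseteq> ?N x \<union> ?N y"
  have yx: "y \<rightarrow>\<^bsub>G\<^esub> x" using xy graph_symmetric by blast
  have V: "x \<in> verts G" "y \<in> verts G" using xy adj_in_verts by auto
  have ne: "x \<noteq> y" "x \<noteq> z" "y \<noteq> z" using xy yx z adj_not_same by auto
  have zn: "\<not> z \<rightarrow>\<^bsub>G\<^esub> x" "\<not> z \<rightarrow>\<^bsub>G\<^esub> y" using z graph_symmetric by blast+
  have cz: "card (?N x \<inter> ?N z) = m" "card (?N y \<inter> ?N z) = m" "card (?N z) = k"
    using card_neighbours_Int_neighbours V z ne card_neighbours_eq by auto
  have zun: "?N z = (?N x \<inter> ?N z) \<union> (?N y \<inter> ?N z)" using sub by blast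
  have un: "card (?N z) + card ((?N x \<inter> ?N z) \<inter> (?N y \<inter> ?N z)) = 2 * m"
    using card_Un_Int[of "?N x \<inter> ?N z" "?N y \<inter> ?N z"] zun cz by simp
  then have "k \<le> 2 * m" using cz by simp
  note par = isolated_vertex_parameters[OF lm k v this]
  have "card ((?N x \<inter> ?N z) \<inter> (?N y \<inter> ?N z)) = 0" using un cz par by simp
  then have empty: "?N x \<inter> ?N y \<inter> ?N z = {}" by auto
  define A B C where "A = ?N x \<inter> ?N y" and "B = ?N x \<inter> ?N z" and "C = ?N y \<inter> ?N z"
  have fin: "finite A" "finite B" "finite C" by (simp_all add: A_def B_def C_def)
  have cA: "card A = l" using card_neighbours_Int_neighbours[OF V] xy ne by (simp add: A_def)
  have disj: "A \<inter> B = {}" "A \<inter> C = {}" "B \<inter> C = {}" using empty by (auto simp: A_def B_def C_def)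
  \<comment> \<open>The inclusion is an equality because both sides have
    \<open>1 + l + m = 2 m = k\<close> elements.\<close>
  have full: "insert u (A \<union> D) = ?N w"
    if "u \<in> ?N w" "u \<notin> A" "u \<notin> D" "D \<subseteq> ?N w" "A \<subseteq> ?N w" "A \<inter> D = {}" "card D = m" "finite D"
      "w \<in> verts G" for u w D
  proof (rule card_subset_eq)
    have "card (insert u (A \<union> D)) = 1 + l + m"
      using that fin cA by (simp add: card_Un_disjoint)
    then show "card (insert u (A \<union> D)) = card (?N w)"
      using that card_neighbours_eq par by simp
  qed (use that in auto)
  have Nx: "insert y (A \<union> B) = ?N x"
    by (rule full) (use xy V zn cz fin disj adj_not_same in \<open>auto simp: A_def B_def\<close>)
  have Ny: "insert x (A \<union> C) = ?N y"
    by (rule full) (use yx V zn cz fin disj adj_not_same in \<open>auto simp: A_def C_def\<close>)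
  have Nz: "B \<union> C = ?N z" using zun by (simp add: B_def C_def)
  have notin: "y \<notin> A \<union> B" "x \<notin> A \<union> C"
    using zn adj_not_same by (auto simp: A_def B_def C_def)
  have split: "card (?N w \<inter> (D \<union> E)) = card (?N w \<inter> D) + card (?N w \<inter> E)"
    if "D \<inter> E = {}" "finite D" "finite E" for w D E
    using that by (subst Int_Un_distrib, subst card_Un_disjoint) auto
  have split_insert: "card (?N w \<inter> insert u D) = of_bool (w \<rightarrow>\<^bsub>G\<^esub> u) + card (?N w \<inter> D)"
    if "u \<notin> D" "finite D" for w u D
    using that by (simp add: Int_insert_right)
  have nx: "card (?N w \<inter> ?N x) = of_bool (w \<rightarrow>\<^bsub>G\<^esub> y) + (card (?N w \<inter> A) + card (?N w \<inter> B))" for w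
    unfolding Nx[symmetric] using notin disj fin by (simp only: split_insert split finite_Un simp_thms)
  have ny: "card (?N w \<inter> ?N y) = of_bool (w \<rightarrow>\<^bsub>G\<^esub> x) + (card (?N w \<inter> A) + card (?N w \<inter> C))" for w
    unfolding Ny[symmetric] using notin disj fin by (simp only: split_insert split finite_Un simp_thms)
  have nz: "card (?N w \<inter> ?N z) = card (?N w \<inter> B) + card (?N w \<inter> C)" for w
    unfolding Nz[symmetric] using disj fin by (simp only: split)
  \<comment> \<open>This is where \<open>m \<ge> 2\<close> is used: \<open>A\<close> has
    \<open>l = m - 1\<close> elements.\<close>
  have "A \<noteq> {}" using cA par by auto
  then obtain a where a: "a \<in> A" by blast
  then have "a \<in> verts G" "x \<rightarrow>\<^bsub>G\<^esub> a" "y \<rightarrow>\<^bsub>G\<^esub> a" using adj_in_verts by (auto simp: A_def)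
  moreover from this have "a \<rightarrow>\<^bsub>G\<^esub> x" "a \<rightarrow>\<^bsub>G\<^esub> y" using graph_symmetric by auto
  moreover have "\<not> a \<rightarrow>\<^bsub>G\<^esub> z" "a \<noteq> z"
    using a empty graph_symmetric z by (auto simp: A_def)
  ultimately have "card (?N a \<inter> ?N x) = l" "card (?N a \<inter> ?N y) = l" "card (?N a \<inter> ?N z) = m"
    using card_neighbours_Int_neighbours[of a] V z adj_not_same by auto
  \<comment> \<open>The equations for \<open>x\<close> and \<open>y\<close> show that
    \<open>a\<close> has equally many neighbours in \<open>B\<close> and in \<open>C\<close>; by the
    equation for \<open>z\<close> these add up to \<open>m\<close>.\<close>
  then have "even m"
    unfolding nx ny nz using \<open>a \<rightarrow>\<^bsub>G\<^esub> x\<close> \<open>a \<rightarrow>\<^bsub>G\<^esub> y\<close> by auto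
  have "B \<noteq> {}" using cz par by (auto simp: B_def)
  then obtain b where b: "b \<in> B" by blast
  then have "b \<in> verts G" "x \<rightarrow>\<^bsub>G\<^esub> b" "z \<rightarrow>\<^bsub>G\<^esub> b" using adj_in_verts by (auto simp: B_def)
  moreover from this have "b \<rightarrow>\<^bsub>G\<^esub> x" "b \<rightarrow>\<^bsub>G\<^esub> z" using graph_symmetric by auto
  moreover have "\<not> b \<rightarrow>\<^bsub>G\<^esub> y" "b \<noteq> y"
    using b empty graph_symmetric zn by (auto simp: B_def)
  ultimately have "card (?N b \<inter> ?N x) = l" "card (?N b \<inter> ?N y) = m" "card (?N b \<inter> ?N z) = l"
    using card_neighbours_Int_neighbours[of b] V z adj_not_same by auto
  then have "card (?N b \<inter> A) + card (?N b \<inter> B) = l" "1 + (card (?N b \<inter> A) + card (?N b \<inter> C)) = m"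
      "card (?N b \<inter> B) + card (?N b \<inter> C) = l"
    unfolding nx ny nz using \<open>b \<rightarrow>\<^bsub>G\<^esub> x\<close> \<open>\<not> b \<rightarrow>\<^bsub>G\<^esub> y\<close> by simp_all
  \<comment> \<open>As \<open>m = l + 1\<close>, the numbers of neighbours of \<open>b\<close> in
    \<open>A\<close>, \<open>B\<close> and \<open>C\<close> have all pairwise sums equal to
    \<open>l\<close>, so they coincide and \<open>l\<close> is even, making \<open>m\<close>
    odd.\<close>
  then show False using \<open>even m\<close> par by presburger
qed

text \<open>Deleting the set cuts \<open>{x, y}\<close> off from the rest. The rest is nonempty by
  the bound on \<open>v\<close>, and none of its vertices is isolated by the previous lemma.\<close>

lemma nonsingleton_disconnecting_set_edge_neighbours:
  assumes lm: "int l - int m \<in> {-1, 0, 1}" and k: "k \<ge> 2 * l + 1" and v: "2 * k + 2 \<le> v + l"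
    and xy: "x \<rightarrow>\<^bsub>G\<^esub> y"
  shows "nonsingleton_disconnecting_set G (neighbours G x \<union> neighbours G y - {x, y})"
    (is "nonsingleton_disconnecting_set G ?S")
proof -
  let ?U = "neighbours G x \<union> neighbours G y"
  have yx: "y \<rightarrow>\<^bsub>G\<^esub> x" using xy graph_symmetric by blast
  have V: "x \<in> verts G" "y \<in> verts G" using xy adj_in_verts by auto
  have U: "?U \<subseteq> verts G" using neighbours_subset by blast
  interpret H: graph "remove_verts G ?S" by (rule graph_remove_verts)
  \<comment> \<open>\<open>?U\<close> has \<open>2 k - l\<close> elements, at most
    \<open>v - 2\<close>.\<close>
  have "card ?U < card (verts G)" using card_neighbours_Un_edge[OF xy] v card_verts by simp
  then obtain z where z: "z \<in> verts G" "z \<notin> ?U" using U by (metis less_irrefl subset_antisym subsetI)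
  have "w \<in> {x, y}" if "x \<rightarrow>\<^sup>*\<^bsub>remove_verts G ?S\<^esub> w" for w
    using that by (induction rule: H.reachable_induct) (auto simp: dominates_remove_verts_iff)
  then have "\<not> x \<rightarrow>\<^sup>*\<^bsub>remove_verts G ?S\<^esub> z" using z xy yx by auto
  moreover have "x \<in> verts (remove_verts G ?S)" "z \<in> verts (remove_verts G ?S)" using V z by auto
  ultimately have "\<not> strongly_connected (remove_verts G ?S)" by (auto simp: strongly_connected_def)
  then have "\<not> Digraph_Component.connected (remove_verts G ?S)"
    using H.symmetric_connected_imp_strongly_connected H.sym_arcs by blast
  then have "disconnecting_set G ?S"
    using U V by (auto simp: disconnecting_set_def)
  moreover have "\<exists>w. u \<rightarrow>\<^bsub>G\<^esub> w \<and> w \<notin> ?S" if u: "u \<in> verts G - ?S" for u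
  proof (cases "u \<in> {x, y}")
    case True
    then show ?thesis using xy yx by auto
  next
    case False
    then show ?thesis
      using neighbours_not_subset_edge_neighbours[OF lm k v xy, of u] u by auto
  qed
  ultimately show ?thesis by (simp add: nonsingleton_disconnecting_set_iff)
qed

text \<open>The given set serves twice: it supplies an edge, whose neighbours attain the value, and
  the lower bound on \<open>v\<close> which that construction requires.\<close>

lemma kappa2_eq:
  assumes "int l - int m \<in> {-1, 0, 1}" "k \<ge> 2 * l + 1" and ex: "\<exists>S. nonsingleton_disconnecting_set G S"
  shows "kappa2 G = 2 * k - l - 2"
  unfolding kappa2_def
proof (rule Least_equality)
  obtain S where S: "nonsingleton_disconnecting_set G S" using ex by blast
  obtain x y where xy: "x \<rightarrow>\<^bsub>G\<^esub> y" by (rule nonsingleton_disconnecting_set_sides[OF S])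
  have "card (neighbours G x \<union> neighbours G y - {x, y}) = 2 * k - l - 2"
  proof -
    have "x \<noteq> y" using xy adj_not_same by auto
    then have "card {x, y} = 2" by simp
    moreover have "{x, y} \<subseteq> neighbours G x \<union> neighbours G y"
      using xy graph_symmetric[OF xy] by auto
    ultimately show ?thesis
      using card_neighbours_Un_edge[OF xy] by (simp add: card_Diff_subset)
  qed
  then show "\<exists>S. nonsingleton_disconnecting_set G S \<and> card S = 2 * k - l - 2"
    using nonsingleton_disconnecting_set_edge_neighbours[OF assms(1,2) card_verts_ge[OF assms(1,2) S] xy]
    by blast
next
  fix n assume "\<exists>S. nonsingleton_disconnecting_set G S \<and> card S = n"
  then show "2 * k - l - 2 \<le> n"
    using card_nonsingleton_disconnecting_set_ge[OF assms(1,2)] by fastforce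
qed

end

theorem lemma2p5:
  fixes G :: "('a, 'b) pre_digraph" and v k l m :: nat
  assumes "strongly_regular_graph G v k l m"
    and "Digraph_Component.connected G"
    and "\<exists>S. nonsingleton_disconnecting_set G S"
    and "int l - int m \<in> {-1, 0, 1}"
    and "k \<ge> 2 * l + 1"
  shows "int (kappa2 G) = 2 * int k - int l - 2"
  \<comment> \<open>The natural subtraction does not truncate: \<open>k \<ge> 2 l + 1\<close> gives
    \<open>2 k \<ge> l + 2\<close>.\<close>
  using strongly_regular_graph.kappa2_eq[OF assms(1,4,5,3)] assms(5) by linarith

end
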